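(* For any Borel probability measures $\sigma,\mu$ on $\mathbb{R}$, there exists a unique Borel probability measure $\mathbb{A}^\lor_\sigma(\mu)$ on $\mathbb{R}$ such that $$\sigma\vee_{\mathrm{f}}\mu=\sigma\lor\mathbb{A}^\lor_\sigma(\mu).$$
   Context: For a Borel probability measure $\mu$ on $\mathbb{R}$, $F_\mu(x):=\mu((-\infty,x])$ is its distribution function. The classical max-convolution $\mu\lor\nu$ is the probability measure with $F_{\mu\lor\nu}(x):=F_\mu(x)F_\nu(x)$, $x\in\mathbb{R}$. The free max-convolution, written here $\mu\vee_{\mathrm{f}}\nu$, is the probability measure with $F_{\mu\vee_{\mathrm{f}}\nu}(x):=\max\{F_\mu(x)+F_\nu(x)-1,0\}$, $x\in\mathbb{R}$.
   Formalization: Uniqueness as stated fails (σ=μ=δ_0: both δ_0 and δ_{-1} work); existence is proved for all σ, μ, uniqueness among measures with no mass on (-∞,x) whenever F_σ(x)=0, and any two solutions have equal distribution functions where F_σ>0. *)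

theory Defs
  imports "HOL-Probability.Probability"
begin

definition max_conv :: "real measure \<Rightarrow> real measure \<Rightarrow> real measure" where
  "max_conv \<mu> \<nu> = interval_measure (\<lambda>x. cdf \<mu> x * cdf \<nu> x)"

definition free_max_conv :: "real measure \<Rightarrow> real measure \<Rightarrow> real measure" where
  "free_max_conv \<mu> \<nu> = interval_measure (\<lambda>x. max (cdf \<mu> x + cdf \<nu> x - 1) 0)"

text \<open>The two definitions are meant for probability measures; there the right-hand sides are
  distribution functions, and both convolutions are the probability measures determined by them.\<close>

lemma
  assumes "real_distribution \<mu>" "real_distribution \<nu>"
  shows real_distribution_max_conv: "real_distribution (max_conv \<mu> \<nu>)"
    and cdf_max_conv: "cdf (max_conv \<mu> \<nu>) x = cdf \<mu> x * cdf \<nu> x"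
proof -
  interpret M: real_distribution \<mu> by fact
  interpret N: real_distribution \<nu> by fact
  let ?F = "\<lambda>x. cdf \<mu> x * cdf \<nu> x"
  have mono: "?F x \<le> ?F y" if "x \<le> y" for x y
    using that by (intro mult_mono M.cdf_nondecreasing N.cdf_nondecreasing M.cdf_nonneg N.cdf_nonneg)
  have cont: "continuous (at_right a) ?F" for a
    by (intro continuous_mult M.cdf_is_right_cont N.cdf_is_right_cont)
  have bot: "(?F \<longlongrightarrow> 0) at_bot"
    using tendsto_mult[OF M.cdf_lim_at_bot N.cdf_lim_at_bot] by simp
  have top: "(?F \<longlongrightarrow> 1) at_top"
    using tendsto_mult[OF M.cdf_lim_at_top_prob N.cdf_lim_at_top_prob] by simp
  show "real_distribution (max_conv \<mu> \<nu>)"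
    unfolding max_conv_def by (rule real_distribution_interval_measure[OF mono cont bot top])
  show "cdf (max_conv \<mu> \<nu>) x = cdf \<mu> x * cdf \<nu> x"
    unfolding max_conv_def using cdf_interval_measure[OF mono cont bot] by (rule fun_cong)
qed

lemma
  assumes "real_distribution \<mu>" "real_distribution \<nu>"
  shows real_distribution_free_max_conv: "real_distribution (free_max_conv \<mu> \<nu>)"
    and cdf_free_max_conv: "cdf (free_max_conv \<mu> \<nu>) x = max (cdf \<mu> x + cdf \<nu> x - 1) 0"
proof -
  interpret M: real_distribution \<mu> by fact
  interpret N: real_distribution \<nu> by fact
  let ?F = "\<lambda>x. max (cdf \<mu> x + cdf \<nu> x - 1) 0"
  have mono: "?F x \<le> ?F y" if "x \<le> y" for x y
    using M.cdf_nondecreasing[OF that] N.cdf_nondecreasing[OF that] by auto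
  have cont: "continuous (at_right a) ?F" for a
    by (intro continuous_max continuous_diff continuous_add continuous_const
          M.cdf_is_right_cont N.cdf_is_right_cont)
  have bot: "(?F \<longlongrightarrow> 0) at_bot"
    using tendsto_max[OF tendsto_diff[OF tendsto_add[OF M.cdf_lim_at_bot N.cdf_lim_at_bot]
      tendsto_const[of 1]] tendsto_const[of 0]] by simp
  have top: "(?F \<longlongrightarrow> 1) at_top"
    using tendsto_max[OF tendsto_diff[OF tendsto_add[OF M.cdf_lim_at_top_prob
      N.cdf_lim_at_top_prob] tendsto_const[of 1]] tendsto_const[of 0]] by simp
  show "real_distribution (free_max_conv \<mu> \<nu>)"
    unfolding free_max_conv_def by (rule real_distribution_interval_measure[OF mono cont bot top])
  show "cdf (free_max_conv \<mu> \<nu>) x = max (cdf \<mu> x + cdf \<nu> x - 1) 0"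
    unfolding free_max_conv_def using cdf_interval_measure[OF mono cont bot] by (rule fun_cong)
qed

text \<open>A pitfall: \<open>max_conv \<sigma> \<nu>\<close> does not see the values of \<open>cdf \<nu>\<close> at points where
  \<open>cdf \<sigma>\<close> vanishes. For instance, if \<open>\<sigma>\<close> is the Dirac measure at \<open>0\<close>, then
  \<open>max_conv \<sigma> \<nu> = \<sigma>\<close> for every \<open>\<nu>\<close> concentrated on \<open>{..0}\<close>. A solution \<open>\<nu>\<close> of
  \<open>free_max_conv \<sigma> \<mu> = max_conv \<sigma> \<nu>\<close> is therefore determined where \<open>cdf \<sigma>\<close> is positive,
  and is unique as a measure once it is required to have no mass below the support of \<open>\<sigma>\<close>,
  i.e. \<open>measure \<nu> {..<x} = 0\<close> whenever \<open>cdf \<sigma> x = 0\<close>. (Demanding \<open>cdf \<nu> x = 0\<close> instead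
  would be too strong: for \<open>\<sigma>\<close> uniform on \<open>{0..1}\<close> and \<open>\<mu>\<close> Dirac at \<open>0\<close>, the only
  solution without mass on \<open>{..<0}\<close> is Dirac at \<open>0\<close>, although \<open>cdf \<sigma> 0 = 0\<close>.)\<close>

end

theory Submission
  imports Defs
begin

text \<open>
  Write \<open>S\<close> and \<open>M\<close> for the distribution functions of \<open>\<sigma>\<close> and \<open>\<mu>\<close>. A solution \<open>\<nu>\<close> has to
  satisfy \<open>max (S x + M x - 1) 0 = S x * cdf \<nu> x\<close> for all \<open>x\<close>, so \<open>cdf \<nu>\<close> is forced to equal the
  quotient \<open>H x = max (S x + M x - 1) 0 / S x\<close> wherever \<open>S\<close> is positive. The quotient is
  nondecreasing there because it is the positive part of \<open>1 - (1 - M x) / S x\<close>, and it tends to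
  \<open>1\<close> at \<open>\<infinity>\<close>. It vanishes near \<open>-\<infinity>\<close>, since there \<open>S + M \<le> 1\<close>.

  With the convention \<open>a / 0 = 0\<close>, \<open>H\<close> is nondecreasing on the whole line, but at the right end
  point of \<open>{x. S x = 0}\<close> it need not be right-continuous: the limit from the right may be
  positive, and \<open>\<nu>\<close> then has an atom at this point. Replacing \<open>H\<close> by its right-continuous
  regularization \<open>x \<mapsto> (INF y\<in>{x<..}. H y)\<close> repairs this without changing \<open>H\<close> where
  \<open>S\<close> is positive. The resulting measure has no mass to the left of a zero of \<open>S\<close>, because
  \<open>H\<close> vanishes at every such zero.

  For uniqueness, let \<open>S x = 0\<close>. Either \<open>S\<close> has another zero beyond \<open>x\<close>, and the support
  condition gives \<open>cdf \<nu> x = 0\<close>, or \<open>S\<close> is positive on all of \<open>{x<..}\<close>, and right-continuity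
  recovers \<open>cdf \<nu> x\<close> from the forced values to the right.
\<close>

section \<open>Right-continuous regularization of monotone functions\<close>

text \<open>For nondecreasing \<open>H\<close> this is the right-hand limit of \<open>H\<close> at \<open>x\<close>.\<close>

definition right_regularization :: "(real \<Rightarrow> real) \<Rightarrow> real \<Rightarrow> real" where
  "right_regularization H x = (INF y\<in>{x<..}. H y)"

lemma right_regularization_le:
  assumes "mono H" "x < y"
  shows "right_regularization H x \<le> H y"
  unfolding right_regularization_def
  using assms by (intro cINF_lower bdd_belowI2[where m = "H x"]) (auto intro: monoD)

lemma le_right_regularization:
  assumes "mono H"
  shows "H x \<le> right_regularization H x"
  unfolding right_regularization_def
  using assms by (intro cINF_greatest) (auto intro: monoD)

lemma mono_right_regularization:
  assumes "mono H"
  shows "mono (right_regularization H)"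
proof
  fix x y :: real
  assume "x \<le> y"
  then show "right_regularization H x \<le> right_regularization H y"
    unfolding right_regularization_def[of H y]
    by (intro cINF_greatest) (auto intro!: right_regularization_le[OF assms])
qed

lemma right_regularization_eq:
  assumes "mono H" and "continuous (at_right x) H"
  shows "right_regularization H x = H x"
proof (rule antisym)
  have "(H \<longlongrightarrow> H x) (at_right x)"
    using assms(2) by (simp add: continuous_within)
  moreover have "eventually (\<lambda>y. right_regularization H x \<le> H y) (at_right x)"
    using eventually_at_right_less[of x]
    by eventually_elim (rule right_regularization_le[OF assms(1)])
  ultimately show "right_regularization H x \<le> H x"
    by (rule tendsto_lowerbound) simp
qed (rule le_right_regularization[OF assms(1)])

lemma right_regularization_right_cont:
  assumes "mono H"
  shows "continuous (at_right x) (right_regularization H)"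
  unfolding continuous_within
proof (rule order_tendstoI)
  let ?G = "right_regularization H"
  fix c assume "c < ?G x"
  moreover have "?G x \<le> ?G y" if "x < y" for y
    using monoD[OF mono_right_regularization[OF assms]] that by simp
  ultimately show "eventually (\<lambda>y. c < ?G y) (at_right x)"
    using eventually_at_right_less[of x] by (auto elim!: eventually_mono intro: less_le_trans)
next
  let ?G = "right_regularization H"
  fix c assume "?G x < c"
  then obtain z where z: "x < z" "H z < c"
    using cINF_less_iff[of "{x<..}" H c] bdd_belowI2[of "{x<..}" "H x" H] monoD[OF assms, of x]
    by (auto simp: right_regularization_def)
  from eventually_at_right_real[OF z(1)]
  show "eventually (\<lambda>y. ?G y < c) (at_right x)"
    using z(2) right_regularization_le[OF assms, of _ z]
    by (auto elim!: eventually_mono intro: le_less_trans)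
qed

lemma right_regularization_tendsto_at_top:
  assumes "mono H" and lim: "(H \<longlongrightarrow> l) at_top"
  shows "(right_regularization H \<longlongrightarrow> l) at_top"
proof (rule tendsto_sandwich[OF _ _ lim])
  show "((\<lambda>x. H (x + 1)) \<longlongrightarrow> l) at_top"
    using lim
  proof (rule filterlim_compose)
    show "filterlim (\<lambda>x::real. x + 1) at_top at_top"
      unfolding filterlim_at_top eventually_at_top_linorder
      by (meson diff_le_eq)
  qed
qed (auto intro!: always_eventually le_right_regularization right_regularization_le assms)

lemma right_regularization_tendsto_at_bot:
  assumes "mono H" and lim: "(H \<longlongrightarrow> l) at_bot"
  shows "(right_regularization H \<longlongrightarrow> l) at_bot"
proof (rule tendsto_sandwich[OF _ _ lim])
  have "filterlim (\<lambda>x::real. x + 1) at_bot at_bot"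
    unfolding filterlim_at_bot eventually_at_bot_linorder
    by (meson le_diff_eq)
  with lim show "((\<lambda>x. H (x + 1)) \<longlongrightarrow> l) at_bot"
    by (rule filterlim_compose)
qed (auto intro!: always_eventually le_right_regularization right_regularization_le assms)

section \<open>The distribution function of the free max-convolution divided by that of \<open>\<sigma>\<close>\<close>

text \<open>Where \<open>cdf \<sigma>\<close> vanishes, the convention \<open>a / 0 = 0\<close> supplies the value \<open>0\<close>, which keeps
  the function nondecreasing and leaves no mass to the left of such points.\<close>

definition quotient_cdf :: "real measure \<Rightarrow> real measure \<Rightarrow> real \<Rightarrow> real" where
  "quotient_cdf \<sigma> \<mu> x = max (cdf \<sigma> x + cdf \<mu> x - 1) 0 / cdf \<sigma> x"

context
  fixes \<sigma> \<mu> :: "real measure"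
  assumes \<sigma>: "real_distribution \<sigma>" and \<mu>: "real_distribution \<mu>"
begin

interpretation S: real_distribution \<sigma> by (rule \<sigma>)
interpretation M: real_distribution \<mu> by (rule \<mu>)

text \<open>At a zero of \<open>cdf \<sigma>\<close> the right-hand side vanishes as well, because \<open>cdf \<mu> \<le> 1\<close>.\<close>

lemma cdf_times_quotient_cdf:
  "cdf \<sigma> x * quotient_cdf \<sigma> \<mu> x = max (cdf \<sigma> x + cdf \<mu> x - 1) 0"
  using M.cdf_bounded_prob[of x] by (cases "cdf \<sigma> x = 0") (auto simp: quotient_cdf_def)

lemma quotient_cdf_nonneg: "0 \<le> quotient_cdf \<sigma> \<mu> x"
  using S.cdf_nonneg[of x] by (simp add: quotient_cdf_def)

text \<open>Monotonicity can be read off in this form: \<open>1 - cdf \<mu>\<close> decreases and \<open>cdf \<sigma>\<close> increases.\<close>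

lemma quotient_cdf_eq_pos_part:
  assumes "0 < cdf \<sigma> x"
  shows "quotient_cdf \<sigma> \<mu> x = max (1 - (1 - cdf \<mu> x) / cdf \<sigma> x) 0"
  using assms by (simp add: quotient_cdf_def max_def field_simps)

lemma mono_quotient_cdf: "mono (quotient_cdf \<sigma> \<mu>)"
proof
  fix x y :: real
  assume le: "x \<le> y"
  show "quotient_cdf \<sigma> \<mu> x \<le> quotient_cdf \<sigma> \<mu> y"
  proof (cases "cdf \<sigma> x = 0")
    case True
    then show ?thesis
      using quotient_cdf_nonneg[of y] by (simp add: quotient_cdf_def)
  next
    case False
    then have pos: "0 < cdf \<sigma> x" "0 < cdf \<sigma> y"
      using S.cdf_nonneg[of x] S.cdf_nondecreasing[OF le] by linarith+
    have "(1 - cdf \<mu> y) / cdf \<sigma> y \<le> (1 - cdf \<mu> x) / cdf \<sigma> x"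
      using pos(1) S.cdf_nondecreasing[OF le] M.cdf_nondecreasing[OF le] M.cdf_bounded_prob[of x]
      by (intro frac_le) auto
    then show ?thesis
      using pos by (simp add: quotient_cdf_eq_pos_part)
  qed
qed

lemma quotient_cdf_right_cont:
  assumes "0 < cdf \<sigma> x"
  shows "continuous (at_right x) (quotient_cdf \<sigma> \<mu>)"
  using S.cdf_is_right_cont[of x] M.cdf_is_right_cont[of x] assms
  unfolding continuous_within quotient_cdf_def[abs_def]
  by (auto intro!: tendsto_intros)

lemma quotient_cdf_at_top: "(quotient_cdf \<sigma> \<mu> \<longlongrightarrow> 1) at_top"
proof -
  have "(quotient_cdf \<sigma> \<mu> \<longlongrightarrow> max (1 + 1 - 1) 0 / 1) at_top"
    unfolding quotient_cdf_def[abs_def]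
    by (intro tendsto_intros S.cdf_lim_at_top_prob M.cdf_lim_at_top_prob) simp
  then show ?thesis by simp
qed

text \<open>The denominator tends to \<open>0\<close> as well, so the limit of the quotient is found from the
  numerator: \<open>cdf \<sigma> + cdf \<mu> - 1\<close> tends to \<open>-1\<close> and its positive part is eventually \<open>0\<close>.\<close>

lemma quotient_cdf_at_bot: "(quotient_cdf \<sigma> \<mu> \<longlongrightarrow> 0) at_bot"
proof (rule tendsto_eventually)
  have "((\<lambda>x. cdf \<sigma> x + cdf \<mu> x) \<longlongrightarrow> 0 + 0) at_bot"
    by (intro tendsto_add S.cdf_lim_at_bot M.cdf_lim_at_bot)
  then have "eventually (\<lambda>x. cdf \<sigma> x + cdf \<mu> x < 1) at_bot"
    by (rule order_tendstoD(2)) simp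
  then show "eventually (\<lambda>x. quotient_cdf \<sigma> \<mu> x = 0) at_bot"
    by eventually_elim (simp add: quotient_cdf_def max_def)
qed

section \<open>Existence and uniqueness\<close>

lemma ex_max_conv_factor:
  "\<exists>\<nu>. real_distribution \<nu> \<and> free_max_conv \<sigma> \<mu> = max_conv \<sigma> \<nu> \<and>
       (\<forall>x. cdf \<sigma> x = 0 \<longrightarrow> measure \<nu> {..<x} = 0)"
proof -
  define G where "G = right_regularization (quotient_cdf \<sigma> \<mu>)"
  define \<nu> where "\<nu> = interval_measure G"
  note mono_H = mono_quotient_cdf
  have mono: "G x \<le> G y" if "x \<le> y" for x y
    unfolding G_def using mono_right_regularization[OF mono_H] that by (rule monoD)
  have cont: "continuous (at_right x) G" for x
    unfolding G_def by (rule right_regularization_right_cont[OF mono_H])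
  have bot: "(G \<longlongrightarrow> 0) at_bot"
    unfolding G_def by (rule right_regularization_tendsto_at_bot[OF mono_H quotient_cdf_at_bot])
  have top: "(G \<longlongrightarrow> 1) at_top"
    unfolding G_def by (rule right_regularization_tendsto_at_top[OF mono_H quotient_cdf_at_top])
  have \<nu>: "real_distribution \<nu>"
    unfolding \<nu>_def by (rule real_distribution_interval_measure[OF mono cont bot top])
  have cdf_\<nu>: "cdf \<nu> = G"
    unfolding \<nu>_def by (rule cdf_interval_measure[OF mono cont bot])
  interpret N: real_distribution \<nu> by (rule \<nu>)

  have "cdf \<sigma> x * cdf \<nu> x = max (cdf \<sigma> x + cdf \<mu> x - 1) 0" for x
  proof (cases "cdf \<sigma> x = 0")
    case True
    then show ?thesis
      using cdf_times_quotient_cdf[of x] by simp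
  next
    case False
    then have "0 < cdf \<sigma> x"
      using S.cdf_nonneg[of x] by simp
    then have "G x = quotient_cdf \<sigma> \<mu> x"
      unfolding G_def by (intro right_regularization_eq mono_H quotient_cdf_right_cont)
    then show ?thesis
      by (simp add: cdf_\<nu> cdf_times_quotient_cdf)
  qed
  then have eq: "free_max_conv \<sigma> \<mu> = max_conv \<sigma> \<nu>"
    unfolding free_max_conv_def max_conv_def by presburger

  have "measure \<nu> {..<x} = 0" if zero: "cdf \<sigma> x = 0" for x
  proof -
    have "cdf \<nu> y \<le> 0" if "y < x" for y
      using right_regularization_le[OF mono_H that] zero
      by (simp add: cdf_\<nu> G_def quotient_cdf_def)
    then have "eventually (\<lambda>y. cdf \<nu> y \<le> 0) (at_left x)"
      using eventually_at_left_real[of "x - 1" x] by (auto elim!: eventually_mono)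
    then have "measure \<nu> {..<x} \<le> 0"
      using N.cdf_at_left[of x] by (intro tendsto_upperbound) auto
    then show ?thesis
      using measure_nonneg[of \<nu> "{..<x}"] by linarith
  qed
  with \<nu> eq show ?thesis
    by (intro exI[of _ \<nu>] conjI allI impI)
qed

end

lemma max_conv_cancel_left:
  assumes "real_distribution \<sigma>" "real_distribution \<nu>" "real_distribution \<nu>'"
    and "max_conv \<sigma> \<nu> = max_conv \<sigma> \<nu>'" and "0 < cdf \<sigma> x"
  shows "cdf \<nu> x = cdf \<nu>' x"
proof -
  have "cdf \<sigma> x * cdf \<nu> x = cdf (max_conv \<sigma> \<nu>) x"
    by (rule cdf_max_conv[OF assms(1,2), symmetric])
  also have "\<dots> = cdf \<sigma> x * cdf \<nu>' x"
    unfolding assms(4) by (rule cdf_max_conv[OF assms(1,3)])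
  finally have "cdf \<sigma> x * cdf \<nu> x = cdf \<sigma> x * cdf \<nu>' x" .
  with assms(5) show ?thesis by simp
qed

text \<open>
  Only the values of \<open>cdf \<nu>\<close> on \<open>{x. cdf \<sigma> x = 0}\<close> remain to be recovered. This set is a down-set,
  so a point \<open>x\<close> of it either lies strictly below another of its points, and then \<open>\<nu>\<close> has no mass
  in \<open>{..x}\<close>, or is its maximum, and then \<open>cdf \<nu>\<close> is already known immediately to its right.
\<close>

lemma max_conv_cancel_left_of_support:
  assumes \<sigma>: "real_distribution \<sigma>" and \<nu>: "real_distribution \<nu>" and \<nu>': "real_distribution \<nu>'"
    and eq: "max_conv \<sigma> \<nu> = max_conv \<sigma> \<nu>'"
    and supp: "\<And>x. cdf \<sigma> x = 0 \<Longrightarrow> measure \<nu> {..<x} = 0"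
    and supp': "\<And>x. cdf \<sigma> x = 0 \<Longrightarrow> measure \<nu>' {..<x} = 0"
  shows "\<nu> = \<nu>'"
proof (rule cdf_unique[OF \<nu> \<nu>'], rule ext)
  fix x
  interpret S: real_distribution \<sigma> by (rule \<sigma>)
  interpret N: real_distribution \<nu> by (rule \<nu>)
  interpret N': real_distribution \<nu>' by (rule \<nu>')
  show "cdf \<nu> x = cdf \<nu>' x"
  proof (cases "\<exists>y>x. cdf \<sigma> y = 0")
    case True
    then obtain y where y: "x < y" "cdf \<sigma> y = 0" by blast
    have "cdf \<nu> x \<le> measure \<nu> {..<y}" "cdf \<nu>' x \<le> measure \<nu>' {..<y}"
      unfolding cdf_def using y(1)
      by (auto intro!: N.finite_measure_mono N'.finite_measure_mono)
    with supp[OF y(2)] supp'[OF y(2)] show ?thesis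
      using N.cdf_nonneg[of x] N'.cdf_nonneg[of x] by simp
  next
    case False
    then have "cdf \<nu> y = cdf \<nu>' y" if "x < y" for y
      using that S.cdf_nonneg[of y]
      by (intro max_conv_cancel_left[OF \<sigma> \<nu> \<nu>' eq]) (auto simp: less_le)
    then have "eventually (\<lambda>y. cdf \<nu> y = cdf \<nu>' y) (at_right x)"
      using eventually_at_right_less[of x] by (auto elim!: eventually_mono)
    moreover have "(cdf \<nu> \<longlongrightarrow> cdf \<nu> x) (at_right x)" "(cdf \<nu>' \<longlongrightarrow> cdf \<nu>' x) (at_right x)"
      using N.cdf_is_right_cont[of x] N'.cdf_is_right_cont[of x] by (auto simp: continuous_within)
    ultimately show ?thesis
      by (metis tendsto_cong tendsto_unique trivial_limit_at_right_real)
  qed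
qed

theorem proposition3p1:
  fixes \<sigma> \<mu> :: "real measure"
  assumes "real_distribution \<sigma>" and "real_distribution \<mu>"
  shows "(\<exists>!\<nu>. real_distribution \<nu> \<and> free_max_conv \<sigma> \<mu> = max_conv \<sigma> \<nu> \<and>
              (\<forall>x. cdf \<sigma> x = 0 \<longrightarrow> measure \<nu> {..<x} = 0)) \<and>
         (\<forall>\<nu> \<nu>'. real_distribution \<nu> \<and> free_max_conv \<sigma> \<mu> = max_conv \<sigma> \<nu> \<and>
              real_distribution \<nu>' \<and> free_max_conv \<sigma> \<mu> = max_conv \<sigma> \<nu>' \<longrightarrow>
              (\<forall>x. cdf \<sigma> x > 0 \<longrightarrow> cdf \<nu> x = cdf \<nu>' x))"
proof (intro conjI ex_ex1I allI impI)
  show "\<exists>\<nu>. real_distribution \<nu> \<and> free_max_conv \<sigma> \<mu> = max_conv \<sigma> \<nu> \<and>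
            (\<forall>x. cdf \<sigma> x = 0 \<longrightarrow> measure \<nu> {..<x} = 0)"
    by (rule ex_max_conv_factor[OF assms])
next
  fix \<nu> \<nu>'
  assume \<nu>: "real_distribution \<nu> \<and> free_max_conv \<sigma> \<mu> = max_conv \<sigma> \<nu> \<and>
               (\<forall>x. cdf \<sigma> x = 0 \<longrightarrow> measure \<nu> {..<x} = 0)"
    and \<nu>': "real_distribution \<nu>' \<and> free_max_conv \<sigma> \<mu> = max_conv \<sigma> \<nu>' \<and>
               (\<forall>x. cdf \<sigma> x = 0 \<longrightarrow> measure \<nu>' {..<x} = 0)"
  then have eq: "max_conv \<sigma> \<nu> = max_conv \<sigma> \<nu>'" by metis
  show "\<nu> = \<nu>'"
    by (rule max_conv_cancel_left_of_support[OF assms(1) _ _ eq]) (use \<nu> \<nu>' in blast)+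
next
  fix \<nu> \<nu>' x
  assume *: "real_distribution \<nu> \<and> free_max_conv \<sigma> \<mu> = max_conv \<sigma> \<nu> \<and>
             real_distribution \<nu>' \<and> free_max_conv \<sigma> \<mu> = max_conv \<sigma> \<nu>'" and pos: "cdf \<sigma> x > 0"
  then have eq: "max_conv \<sigma> \<nu> = max_conv \<sigma> \<nu>'" by metis
  show "cdf \<nu> x = cdf \<nu>' x"
    using max_conv_cancel_left[OF assms(1) _ _ eq pos] * by blast
qed

end
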